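(* Let $n\ge 1$ be an integer and let $U_{6n}=\langle a,b : a^{2n}=b^3=1,\ a^{-1}ba=b^{-1}\rangle$. Then \[ \mathrm{CSCom}(U_{6n})\cong K_n\vee(K_{2n}\sqcup K_{3n}). \]
   Context: For a finite group $G$, the conjugacy super commuting graph $\mathrm{CSCom}(G)$ is the simple graph with vertex set $G$ in which two distinct vertices $g,h$ are adjacent if and only if either $g$ and $h$ are conjugate in $G$, or there exist $g'$ in the conjugacy class of $g$ and $h'$ in the conjugacy class of $h$ with $g'h'=h'g'$. $K_r$ is the complete graph on $r$ vertices, $\sqcup$ is disjoint union of graphs, and $\vee$ is the join of graphs (disjoint union together with all edges between the two vertex sets). *)

theory Defs
  imports "HOL-Algebra.Group_Action" "Graph_Theory.Graph_Theory"
begin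

section \<open>Groups given by generators and relations\<close>

datatype 'x letter = Pos 'x | Neg 'x

fun flip_letter :: "'x letter \<Rightarrow> 'x letter" where
  "flip_letter (Pos x) = Neg x"
| "flip_letter (Neg x) = Pos x"

type_synonym 'x word = "'x letter list"

text \<open>
  The generators are all elements of the type \<open>'x\<close>; a pair \<open>(u, v)\<close> in \<open>R\<close> stands for
  the relation \<open>u = v\<close>. The relation below is the congruence on words whose quotient is
  the group presented by these generators and relations.
\<close>

inductive pres_eq :: "('x word \<times> 'x word) set \<Rightarrow> 'x word \<Rightarrow> 'x word \<Rightarrow> bool"
  for R where
  rel: "(u, v) \<in> R \<Longrightarrow> pres_eq R u v"
| cancel: "pres_eq R [l, flip_letter l] []"
| refl: "pres_eq R u u"
| sym: "pres_eq R u v \<Longrightarrow> pres_eq R v u"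
| trans: "pres_eq R u v \<Longrightarrow> pres_eq R v w \<Longrightarrow> pres_eq R u w"
| append: "pres_eq R u u' \<Longrightarrow> pres_eq R v v' \<Longrightarrow> pres_eq R (u @ v) (u' @ v')"

definition word_class :: "('x word \<times> 'x word) set \<Rightarrow> 'x word \<Rightarrow> 'x word set" where
  "word_class R w = {v. pres_eq R w v}"

definition presented_group :: "('x word \<times> 'x word) set \<Rightarrow> 'x word set monoid" where
  "presented_group R =
    \<lparr> carrier = range (word_class R),
      monoid.mult = (\<lambda>A B. \<Union>u\<in>A. \<Union>v\<in>B. word_class R (u @ v)),
      one = word_class R [] \<rparr>"

lemma word_class_eq_iff: "word_class R u = word_class R v \<longleftrightarrow> pres_eq R u v"
  unfolding word_class_def
  by (auto intro: pres_eq.refl pres_eq.sym pres_eq.trans)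

lemma carrier_presented_group_quotient:
  "carrier (presented_group R) = UNIV // {(u, v). pres_eq R u v}"
  by (auto simp: presented_group_def quotient_def word_class_def)

lemma mult_presented_group:
  "word_class R u \<otimes>\<^bsub>presented_group R\<^esub> word_class R v = word_class R (u @ v)"
proof -
  have *: "word_class R (u' @ v') = word_class R (u @ v)"
    if "u' \<in> word_class R u" "v' \<in> word_class R v" for u' v'
    using that unfolding word_class_eq_iff
    by (auto simp: word_class_def intro: pres_eq.sym pres_eq.append)
  have "(\<Union>u'\<in>word_class R u. \<Union>v'\<in>word_class R v. word_class R (u' @ v')) =
      (\<Union>u'\<in>word_class R u. \<Union>v'\<in>word_class R v. word_class R (u @ v))"
    by (intro SUP_cong HOL.refl *)
  moreover have "word_class R u \<noteq> {}" "word_class R v \<noteq> {}"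
    by (auto simp: word_class_def intro: pres_eq.refl)
  ultimately show ?thesis
    by (simp add: presented_group_def)
qed

lemma one_presented_group: "\<one>\<^bsub>presented_group R\<^esub> = word_class R []"
  by (simp add: presented_group_def)

lemma word_class_closed: "word_class R w \<in> carrier (presented_group R)"
  by (simp add: presented_group_def)

lemma flip_letter_flip_letter: "flip_letter (flip_letter l) = l"
  by (cases l) auto

lemma pres_eq_inverse: "pres_eq R (rev (map flip_letter w) @ w) []"
proof (induction w)
  case Nil
  show ?case by (simp add: pres_eq.refl)
next
  case (Cons l w)
  have "pres_eq R [flip_letter l, l] []"
    using pres_eq.cancel[of R "flip_letter l"] by (simp add: flip_letter_flip_letter)
  then have "pres_eq R ([flip_letter l, l] @ w) w"
    using pres_eq.append[of R "[flip_letter l, l]" "[]" w w] by (simp add: pres_eq.refl)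
  then have "pres_eq R (rev (map flip_letter w) @ [flip_letter l, l] @ w)
      (rev (map flip_letter w) @ w)"
    by (intro pres_eq.append pres_eq.refl)
  from this Cons.IH have "pres_eq R (rev (map flip_letter w) @ [flip_letter l, l] @ w) []"
    by (rule pres_eq.trans)
  then show ?case
    by simp
qed

lemma group_presented_group: "group (presented_group R)"
proof (rule groupI)
  fix A B assume "A \<in> carrier (presented_group R)" "B \<in> carrier (presented_group R)"
  then obtain u v where "A = word_class R u" "B = word_class R v"
    by (auto simp: presented_group_def)
  then show "A \<otimes>\<^bsub>presented_group R\<^esub> B \<in> carrier (presented_group R)"
    by (simp add: mult_presented_group word_class_closed)
next
  show "\<one>\<^bsub>presented_group R\<^esub> \<in> carrier (presented_group R)"
    by (simp add: presented_group_def)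
next
  fix A B C
  assume "A \<in> carrier (presented_group R)" "B \<in> carrier (presented_group R)"
    "C \<in> carrier (presented_group R)"
  then obtain u v w where "A = word_class R u" "B = word_class R v" "C = word_class R w"
    by (auto simp: presented_group_def)
  then show "A \<otimes>\<^bsub>presented_group R\<^esub> B \<otimes>\<^bsub>presented_group R\<^esub> C =
      A \<otimes>\<^bsub>presented_group R\<^esub> (B \<otimes>\<^bsub>presented_group R\<^esub> C)"
    by (simp add: mult_presented_group)
next
  fix A assume "A \<in> carrier (presented_group R)"
  then obtain u where u: "A = word_class R u"
    by (auto simp: presented_group_def)
  then show "\<one>\<^bsub>presented_group R\<^esub> \<otimes>\<^bsub>presented_group R\<^esub> A = A"
    by (simp add: mult_presented_group one_presented_group)
  show "\<exists>B\<in>carrier (presented_group R). B \<otimes>\<^bsub>presented_group R\<^esub> A = \<one>\<^bsub>presented_group R\<^esub>"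
    by (rule bexI[of _ "word_class R (rev (map flip_letter u))"])
      (simp_all add: u mult_presented_group one_presented_group word_class_eq_iff
        pres_eq_inverse word_class_closed)
qed

fun letter_eval :: "('g, 'm) monoid_scheme \<Rightarrow> ('x \<Rightarrow> 'g) \<Rightarrow> 'x letter \<Rightarrow> 'g" where
  "letter_eval H f (Pos x) = f x"
| "letter_eval H f (Neg x) = inv\<^bsub>H\<^esub> f x"

fun word_eval :: "('g, 'm) monoid_scheme \<Rightarrow> ('x \<Rightarrow> 'g) \<Rightarrow> 'x word \<Rightarrow> 'g" where
  "word_eval H f [] = \<one>\<^bsub>H\<^esub>"
| "word_eval H f (l # w) = letter_eval H f l \<otimes>\<^bsub>H\<^esub> word_eval H f w"

text \<open>Every element is a product of generators and their inverses.\<close>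

lemma word_eval_presented_group:
  "word_eval (presented_group R) (\<lambda>x. word_class R [Pos x]) w = word_class R w"
proof (induction w)
  case Nil
  show ?case by (simp add: one_presented_group)
next
  case (Cons l w)
  interpret group "presented_group R" by (rule group_presented_group)
  have "inv\<^bsub>presented_group R\<^esub> (word_class R [Pos x]) = word_class R [Neg x]" for x
    by (rule inv_equality)
      (use pres_eq.cancel[of R "Neg x"] in \<open>simp_all add: mult_presented_group
        one_presented_group word_class_eq_iff word_class_closed\<close>)
  then have "letter_eval (presented_group R) (\<lambda>x. word_class R [Pos x]) l = word_class R [l]"
    by (cases l) auto
  with Cons show ?case
    by (simp add: mult_presented_group)
qed

text \<open>The relations hold, and the presented group is universal with this property.\<close>

lemma presented_group_relation:
  assumes "(u, v) \<in> R"
  shows "word_eval (presented_group R) (\<lambda>x. word_class R [Pos x]) u =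
    word_eval (presented_group R) (\<lambda>x. word_class R [Pos x]) v"
  using assms by (simp add: word_eval_presented_group word_class_eq_iff pres_eq.rel)

lemma presented_group_universal:
  assumes "group H" and f: "\<And>x. f x \<in> carrier H"
    and R: "\<And>u v. (u, v) \<in> R \<Longrightarrow> word_eval H f u = word_eval H f v"
  shows "\<exists>h \<in> hom (presented_group R) H. \<forall>w. h (word_class R w) = word_eval H f w"
proof -
  interpret H: group H by fact
  have letter: "letter_eval H f l \<in> carrier H" for l
    by (cases l) (auto simp: f)
  have closed: "word_eval H f w \<in> carrier H" for w
    by (induction w) (auto simp: letter)
  have append: "word_eval H f (u @ v) = word_eval H f u \<otimes>\<^bsub>H\<^esub> word_eval H f v" for u v
    by (induction u) (auto simp: letter closed H.m_assoc)
  have "word_eval H f u = word_eval H f v" if "pres_eq R u v" for u v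
    using that
  proof induction
    case (cancel l)
    then show ?case by (cases l) (auto simp: f)
  qed (auto simp: R append)
  then have eval: "word_eval H f (SOME w. word_class R u = word_class R w) = word_eval H f u" for u
    by (metis (mono_tags, lifting) someI word_class_eq_iff)
  define h where "h A = word_eval H f (SOME w. A = word_class R w)" for A
  have h: "h (word_class R w) = word_eval H f w" for w
    unfolding h_def by (rule eval)
  have "h \<in> hom (presented_group R) H"
  proof (rule homI)
    fix A assume "A \<in> carrier (presented_group R)"
    then show "h A \<in> carrier H"
      by (auto simp: presented_group_def h closed)
  next
    fix A B assume "A \<in> carrier (presented_group R)" "B \<in> carrier (presented_group R)"
    then obtain u v where "A = word_class R u" "B = word_class R v"
      by (auto simp: presented_group_def)
    then show "h (A \<otimes>\<^bsub>presented_group R\<^esub> B) = h A \<otimes>\<^bsub>H\<^esub> h B"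
      by (simp add: mult_presented_group h append)
  qed
  with h show ?thesis by blast
qed

subsection \<open>The group \<open>U\<^sub>6\<^sub>n\<close>\<close>

datatype U6n_gen = gen_a | gen_b

definition U6n_rels :: "nat \<Rightarrow> (U6n_gen word \<times> U6n_gen word) set" where
  "U6n_rels n =
    {(replicate (2 * n) (Pos gen_a), []),
     (replicate 3 (Pos gen_b), []),
     ([Neg gen_a, Pos gen_b, Pos gen_a], [Neg gen_b])}"

definition U6n :: "nat \<Rightarrow> U6n_gen word set monoid" where
  "U6n n = presented_group (U6n_rels n)"

section \<open>Graphs\<close>

text \<open>A simple graph is a symmetric loop-free digraph whose arcs are pairs of vertices.\<close>

definition complete_graph :: "nat \<Rightarrow> nat pair_pre_digraph" where
  "complete_graph r =
    \<lparr> pverts = {..<r}, parcs = {(u, v). u < r \<and> v < r \<and> u \<noteq> v} \<rparr>"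

definition graph_disjoint_union ::
    "'a pair_pre_digraph \<Rightarrow> 'b pair_pre_digraph \<Rightarrow> ('a + 'b) pair_pre_digraph"
    (infixr \<open>\<squnion>\<^sub>G\<close> 65) where
  "G \<squnion>\<^sub>G H =
    \<lparr> pverts = pverts G <+> pverts H,
      parcs = map_prod Inl Inl ` parcs G \<union> map_prod Inr Inr ` parcs H \<rparr>"

definition graph_join ::
    "'a pair_pre_digraph \<Rightarrow> 'b pair_pre_digraph \<Rightarrow> ('a + 'b) pair_pre_digraph"
    (infixr \<open>\<or>\<^sub>G\<close> 60) where
  "G \<or>\<^sub>G H =
    \<lparr> pverts = pverts (G \<squnion>\<^sub>G H),
      parcs = parcs (G \<squnion>\<^sub>G H) \<union>
        (Inl ` pverts G) \<times> (Inr ` pverts H) \<union> (Inr ` pverts H) \<times> (Inl ` pverts G) \<rparr>"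

definition graph_iso :: "'a pair_pre_digraph \<Rightarrow> 'b pair_pre_digraph \<Rightarrow> bool"
    (infix \<open>\<cong>\<^sub>G\<close> 50) where
  "G \<cong>\<^sub>G H \<longleftrightarrow> digraph_iso (with_proj G) (with_proj H)"

lemma complete_digraph_complete_graph: "complete_digraph r (with_proj (complete_graph r))"
proof -
  have "finite {(u, v). u < r \<and> v < r \<and> u \<noteq> v}"
    by (rule finite_subset[of _ "{..<r} \<times> {..<r}"]) auto
  then have "pair_graph (complete_graph r)"
    by unfold_locales (auto simp: complete_graph_def symmetric_def sym_def)
  then interpret pair_graph "complete_graph r" .
  have "graph (with_proj (complete_graph r))"
    by unfold_locales
  then show ?thesis
    by (auto simp: complete_digraph_def complete_graph_def)
qed

text \<open>
  Without parallel arcs, isomorphism of digraphs is a bijection of the vertex sets that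
  preserves and reflects adjacency.
\<close>

lemma graph_iso_iff:
  assumes G: "pair_wf_digraph G" and H: "pair_wf_digraph H"
  shows "G \<cong>\<^sub>G H \<longleftrightarrow>
    (\<exists>f. bij_betw f (pverts G) (pverts H) \<and>
      (\<forall>u\<in>pverts G. \<forall>v\<in>pverts G. (u, v) \<in> parcs G \<longleftrightarrow> (f u, f v) \<in> parcs H))"
    (is "?L \<longleftrightarrow> (\<exists>f. ?P f)")
proof
  assume ?L
  then obtain i where i: "pre_digraph.digraph_isomorphism (with_proj G) i"
    and eq: "with_proj H = app_iso i (with_proj G)"
    unfolding graph_iso_def digraph_iso_def by blast
  define f where "f = iso_verts i"
  have verts: "pverts H = f ` pverts G" and arcs: "parcs H = iso_arcs i ` parcs G"
    and th: "iso_tail i = fst" "iso_head i = snd"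
    using eq by (auto simp: with_proj_def app_iso_def f_def)
  have inj: "inj_on f (pverts G)"
    using i by (simp add: pre_digraph.digraph_isomorphism_def f_def)
  have ia: "iso_arcs i (u, v) = (f u, f v)" if "(u, v) \<in> parcs G" for u v
    using i that th by (auto simp: pre_digraph.digraph_isomorphism_def f_def prod_eq_iff)
  have "(u, v) \<in> parcs G \<longleftrightarrow> (f u, f v) \<in> parcs H"
    if uv: "u \<in> pverts G" "v \<in> pverts G" for u v
  proof
    assume "(u, v) \<in> parcs G"
    then show "(f u, f v) \<in> parcs H"
      using ia[of u v] arcs by (metis imageI)
  next
    assume "(f u, f v) \<in> parcs H"
    then obtain u' v' where 1: "(u', v') \<in> parcs G" "(f u, f v) = iso_arcs i (u', v')"
      using arcs by auto
    then have "f u = f u'" "f v = f v'"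
      using ia by auto
    moreover have "u' \<in> pverts G" "v' \<in> pverts G"
      using 1 G by (auto dest: pair_wf_digraph.in_arcsD1 pair_wf_digraph.in_arcsD2)
    ultimately have "u = u'" "v = v'"
      using inj uv by (auto dest: inj_onD)
    with 1 show "(u, v) \<in> parcs G" by simp
  qed
  with inj verts have "?P f"
    by (auto simp: bij_betw_def)
  then show "\<exists>f. ?P f"
    by (rule exI[of ?P])
next
  assume "\<exists>f. ?P f"
  then obtain f where f: "?P f"
    by (rule exE)
  define i where "i = \<lparr> iso_verts = f, iso_arcs = map_prod f f, iso_head = snd, iso_tail = fst \<rparr>"
  interpret G: pair_wf_digraph G by fact
  interpret H: pair_wf_digraph H by fact
  have inj: "inj_on f (pverts G)" and img: "f ` pverts G = pverts H"
    using f by (auto simp: bij_betw_def)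
  have sub: "parcs G \<subseteq> pverts G \<times> pverts G"
    by (auto dest: G.in_arcsD1 G.in_arcsD2)
  have "inj_on (map_prod f f) (parcs G)"
    by (rule inj_on_subset[OF map_prod_inj_on[OF inj inj] sub])
  then have "pre_digraph.digraph_isomorphism (with_proj G) i"
    using inj G.wf_digraph by (auto simp: pre_digraph.digraph_isomorphism_def i_def)
  moreover have "map_prod f f ` parcs G = parcs H"
  proof
    show "map_prod f f ` parcs G \<subseteq> parcs H"
      using f sub by auto
    show "parcs H \<subseteq> map_prod f f ` parcs G"
    proof
      fix e assume e: "e \<in> parcs H"
      then have "fst e \<in> f ` pverts G" "snd e \<in> f ` pverts G"
        using img H.arc_fst_in_verts H.arc_snd_in_verts by auto
      then obtain u v where "u \<in> pverts G" "v \<in> pverts G" "e = (f u, f v)"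
        by (metis imageE prod.collapse)
      then show "e \<in> map_prod f f ` parcs G"
        using f e by (metis imageI map_prod_simp)
    qed
  qed
  with img have "with_proj H = app_iso i (with_proj G)"
    by (simp add: with_proj_def app_iso_def i_def)
  ultimately show ?L
    unfolding graph_iso_def digraph_iso_def by blast
qed

section \<open>The conjugacy super commuting graph\<close>

definition conjugacy_class :: "('g, 'm) monoid_scheme \<Rightarrow> 'g \<Rightarrow> 'g set" where
  "conjugacy_class G g = {x \<otimes>\<^bsub>G\<^esub> g \<otimes>\<^bsub>G\<^esub> inv\<^bsub>G\<^esub> x | x. x \<in> carrier G}"

lemma conjugacy_class_orbit:
  assumes "g \<in> carrier G"
  shows "conjugacy_class G g =
    Group_Action.orbit G (\<lambda>x. \<lambda>h\<in>carrier G. x \<otimes>\<^bsub>G\<^esub> h \<otimes>\<^bsub>G\<^esub> inv\<^bsub>G\<^esub> x) g"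
  using assms by (simp add: conjugacy_class_def Group_Action.orbit_def)

definition CSCom :: "('g, 'm) monoid_scheme \<Rightarrow> 'g pair_pre_digraph" where
  "CSCom G =
    \<lparr> pverts = carrier G,
      parcs = {(g, h). g \<in> carrier G \<and> h \<in> carrier G \<and> g \<noteq> h \<and>
        (h \<in> conjugacy_class G g \<or>
         (\<exists>g'\<in>conjugacy_class G g. \<exists>h'\<in>conjugacy_class G h.
            g' \<otimes>\<^bsub>G\<^esub> h' = h' \<otimes>\<^bsub>G\<^esub> g'))} \<rparr>"

lemma (in group) conjugacy_class_sym:
  assumes g: "g \<in> carrier G" and h: "h \<in> conjugacy_class G g"
  shows "g \<in> conjugacy_class G h"
proof -
  obtain x where x: "x \<in> carrier G" "h = x \<otimes> g \<otimes> inv x"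
    using h by (auto simp: conjugacy_class_def)
  have "inv x \<otimes> (x \<otimes> g) = g"
    using x(1) g by (simp add: m_assoc[symmetric])
  then have "g = inv x \<otimes> h \<otimes> inv (inv x)"
    using x(1) g unfolding x(2) by (simp add: m_assoc)
  then show ?thesis
    using x(1) unfolding conjugacy_class_def by (auto intro!: exI[of _ "inv x"])
qed

lemma (in group) CSCom_pair_graph:
  assumes "finite (carrier G)"
  shows "pair_graph (CSCom G)"
proof -
  have "(h, g) \<in> parcs (CSCom G)" if "(g, h) \<in> parcs (CSCom G)" for g h
    using that conjugacy_class_sym[of g h] unfolding CSCom_def by (simp, metis)
  then have "sym (parcs (CSCom G))"
    unfolding sym_def by blast
  moreover have "finite (parcs (CSCom G))"
    by (rule finite_subset[of _ "carrier G \<times> carrier G"]) (auto simp: CSCom_def assms)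
  ultimately show ?thesis
    by unfold_locales (auto simp: symmetric_def CSCom_def assms)
qed

end

theory Submission
  imports Defs
begin

text \<open>
  Every element of \<open>U\<^sub>6\<^sub>n\<close> is \<open>a\<^sup>i b\<^sup>j\<close> with \<open>i < 2n\<close> and \<open>j < 3\<close>, and conjugation by
  \<open>a\<close> inverts \<open>b\<close>. The three parts of the graph are read off from this normal form.
  The \<open>n\<close> elements \<open>a\<^sup>i\<close> with \<open>i\<close> even are central, so each of them is adjacent to every
  other vertex. The \<open>2n\<close> elements \<open>a\<^sup>i b\<^sup>j\<close> with \<open>i\<close> even and \<open>j \<noteq> 0\<close> lie in the abelian
  subgroup generated by \<open>a\<^sup>2\<close> and \<open>b\<close>, so they form a clique. The \<open>3n\<close> elements with \<open>i\<close> odd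
  form a clique as well, because \<open>a\<^sup>i b\<^sup>j\<close> is conjugate to the power \<open>a\<^sup>i\<close>. Each of the three
  sets is closed under conjugation, and an element with \<open>i\<close> odd acts on \<open>\<langle>b\<rangle>\<close> by
  inversion, hence never commutes with an element of the second set: there are no edges
  between the second and the third set.

  That the normal forms are pairwise distinct cannot be seen from the relations alone.
  It follows from a concrete group, the semidirect product of \<open>\<int>/2n\<close> and \<open>\<int>/3\<close>, in which
  the relations hold: the homomorphism given by the universal property
  (\<open>presented_group_universal\<close>) sends \<open>a\<^sup>i b\<^sup>j\<close> to the pair \<open>(i, j)\<close>, so together with the
  normal form it is an isomorphism (\<open>U6n_iso_semidirect\<close>). Adjacency is computed in this
  group (\<open>CSCom_semidirect_adjacent\<close>) and transported along the isomorphism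
  (\<open>CSCom_iso_adjacent\<close>).
\<close>

section \<open>Graph isomorphisms\<close>

lemma graph_iso_trans:
  assumes wf: "pair_wf_digraph G" "pair_wf_digraph H" "pair_wf_digraph K"
    and GH: "G \<cong>\<^sub>G H" and HK: "H \<cong>\<^sub>G K"
  shows "G \<cong>\<^sub>G K"
proof -
  obtain f where f: "bij_betw f (pverts G) (pverts H)"
    "\<forall>u\<in>pverts G. \<forall>v\<in>pverts G. (u, v) \<in> parcs G \<longleftrightarrow> (f u, f v) \<in> parcs H"
    using GH unfolding graph_iso_iff[OF wf(1,2)] by blast
  obtain g where g: "bij_betw g (pverts H) (pverts K)"
    "\<forall>u\<in>pverts H. \<forall>v\<in>pverts H. (u, v) \<in> parcs H \<longleftrightarrow> (g u, g v) \<in> parcs K"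
    using HK unfolding graph_iso_iff[OF wf(2,3)] by blast
  have "f u \<in> pverts H" if "u \<in> pverts G" for u
    using f(1) that by (auto simp: bij_betw_def)
  with f g show ?thesis
    unfolding graph_iso_iff[OF wf(1,3)]
    by (intro exI[of _ "g \<circ> f"]) (auto intro: bij_betw_trans)
qed

lemma wf_complete_graph: "pair_wf_digraph (complete_graph r)"
  by unfold_locales (auto simp: complete_graph_def)

lemma wf_graph_disjoint_union:
  assumes "pair_wf_digraph G" "pair_wf_digraph H"
  shows "pair_wf_digraph (G \<squnion>\<^sub>G H)"
proof -
  interpret G: pair_wf_digraph G by fact
  interpret H: pair_wf_digraph H by fact
  show ?thesis
    by unfold_locales
      (auto simp: graph_disjoint_union_def dest: G.in_arcsD1 G.in_arcsD2 H.in_arcsD1 H.in_arcsD2)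
qed

lemma wf_graph_join:
  assumes "pair_wf_digraph G" "pair_wf_digraph H"
  shows "pair_wf_digraph (G \<or>\<^sub>G H)"
proof -
  interpret GH: pair_wf_digraph "G \<squnion>\<^sub>G H"
    using assms by (rule wf_graph_disjoint_union)
  show ?thesis
    by unfold_locales
      (auto simp: graph_join_def graph_disjoint_union_def[of G H, THEN arg_cong[of _ _ pverts]]
        dest: GH.in_arcsD1 GH.in_arcsD2)
qed

lemma wf_CSCom: "pair_wf_digraph (CSCom G)"
  by unfold_locales (auto simp: CSCom_def)

text \<open>
  The form in which \<open>K\<^sub>p \<or> (K\<^sub>q \<squnion> K\<^sub>r)\<close> will be recognised: two distinct vertices fail to be
  adjacent exactly if one lies in \<open>B\<close> and the other in \<open>C\<close>. Any enumerations of the three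
  parts then fit together to an isomorphism.
\<close>

lemma graph_iso_join_of_complete:
  assumes wf: "pair_wf_digraph G"
    and verts: "pverts G = A \<union> B \<union> C"
    and disj: "A \<inter> B = {}" "A \<inter> C = {}" "B \<inter> C = {}"
    and fin: "finite A" "finite B" "finite C"
    and card: "card A = p" "card B = q" "card C = r"
    and adj: "\<And>u v. u \<in> pverts G \<Longrightarrow> v \<in> pverts G \<Longrightarrow>
      (u, v) \<in> parcs G \<longleftrightarrow> u \<noteq> v \<and> \<not> (u \<in> B \<and> v \<in> C) \<and> \<not> (u \<in> C \<and> v \<in> B)"
  shows "G \<cong>\<^sub>G complete_graph p \<or>\<^sub>G (complete_graph q \<squnion>\<^sub>G complete_graph r)"
    (is "G \<cong>\<^sub>G ?K")
proof -
  obtain \<alpha> where \<alpha>: "bij_betw \<alpha> A {..<p}"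
    using ex_bij_betw_finite_nat[OF fin(1)] card by (auto simp: lessThan_atLeast0)
  obtain \<beta> where \<beta>: "bij_betw \<beta> B {..<q}"
    using ex_bij_betw_finite_nat[OF fin(2)] card by (auto simp: lessThan_atLeast0)
  obtain \<gamma> where \<gamma>: "bij_betw \<gamma> C {..<r}"
    using ex_bij_betw_finite_nat[OF fin(3)] card by (auto simp: lessThan_atLeast0)
  define f where "f u = (if u \<in> A then Inl (\<alpha> u)
    else if u \<in> B then Inr (Inl (\<beta> u)) else Inr (Inr (\<gamma> u)))" for u
  have fA: "f u = Inl (\<alpha> u)" "\<alpha> u < p" if "u \<in> A" for u
    using that \<alpha> by (auto simp: f_def bij_betw_def)
  have fB: "f u = Inr (Inl (\<beta> u))" "\<beta> u < q" if "u \<in> B" for u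
    using that \<beta> disj by (auto simp: f_def bij_betw_def)
  have fC: "f u = Inr (Inr (\<gamma> u))" "\<gamma> u < r" if "u \<in> C" for u
    using that \<gamma> disj by (auto simp: f_def bij_betw_def)
  have vK: "pverts ?K = {..<p} <+> ({..<q} <+> {..<r})"
    by (simp add: graph_join_def graph_disjoint_union_def complete_graph_def)
  have inj: "\<alpha> u = \<alpha> v \<longleftrightarrow> u = v" if "u \<in> A" "v \<in> A" for u v
    using \<alpha> that by (auto simp: bij_betw_def dest: inj_onD)
  have inj': "\<beta> u = \<beta> v \<longleftrightarrow> u = v" if "u \<in> B" "v \<in> B" for u v
    using \<beta> that by (auto simp: bij_betw_def dest: inj_onD)
  have inj'': "\<gamma> u = \<gamma> v \<longleftrightarrow> u = v" if "u \<in> C" "v \<in> C" for u v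
    using \<gamma> that by (auto simp: bij_betw_def dest: inj_onD)
  have arcs:
    "(Inl i, Inl i') \<in> parcs ?K \<longleftrightarrow> i < p \<and> i' < p \<and> i \<noteq> i'"
    "(Inl i, Inr s) \<in> parcs ?K \<longleftrightarrow> i < p \<and> s \<in> {..<q} <+> {..<r}"
    "(Inr s, Inl i) \<in> parcs ?K \<longleftrightarrow> i < p \<and> s \<in> {..<q} <+> {..<r}"
    "(Inr (Inl j), Inr (Inl j')) \<in> parcs ?K \<longleftrightarrow> j < q \<and> j' < q \<and> j \<noteq> j'"
    "(Inr (Inr k), Inr (Inr k')) \<in> parcs ?K \<longleftrightarrow> k < r \<and> k' < r \<and> k \<noteq> k'"
    "(Inr (Inl j), Inr (Inr k)) \<notin> parcs ?K"
    "(Inr (Inr k), Inr (Inl j)) \<notin> parcs ?K" for i i' s j j' k k'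
    by (force simp: graph_join_def graph_disjoint_union_def complete_graph_def)+
  have "bij_betw f (pverts G) (pverts ?K)"
  proof -
    have "bij_betw f A (Inl ` {..<p})"
      using \<alpha> fA by (auto simp: bij_betw_def inj_on_def image_def)
    moreover have "bij_betw f B (Inr ` Inl ` {..<q})"
      using \<beta> fB by (auto simp: bij_betw_def inj_on_def image_def set_eq_iff)
    moreover have "bij_betw f C (Inr ` Inr ` {..<r})"
      using \<gamma> fC by (auto simp: bij_betw_def inj_on_def image_def set_eq_iff)
    ultimately have "bij_betw f (A \<union> B \<union> C)
        (Inl ` {..<p} \<union> Inr ` Inl ` {..<q} \<union> Inr ` Inr ` {..<r})"
      by (intro bij_betw_combine) auto
    moreover have "pverts ?K = Inl ` {..<p} \<union> Inr ` Inl ` {..<q} \<union> Inr ` Inr ` {..<r}"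
      unfolding vK by (auto simp: Plus_def)
    ultimately show ?thesis
      by (simp add: verts)
  qed
  moreover have "(u, v) \<in> parcs G \<longleftrightarrow> (f u, f v) \<in> parcs ?K"
    if uv: "u \<in> pverts G" "v \<in> pverts G" for u v
  proof -
    have "u \<in> A \<or> u \<in> B \<or> u \<in> C" "v \<in> A \<or> v \<in> B \<or> v \<in> C"
      using uv verts by auto
    then show ?thesis
      by (elim disjE) (use disj in \<open>auto simp: adj[OF uv] fA fB fC arcs inj inj' inj''\<close>)
  qed
  moreover have "pair_wf_digraph ?K"
    by (intro wf_graph_join wf_graph_disjoint_union wf_complete_graph)
  ultimately show ?thesis
    by (subst graph_iso_iff[OF wf]) blast+
qed

section \<open>The conjugacy super commuting graph as a group invariant\<close>

text \<open>The equation \<open>h z = z g\<close> makes conjugacy checkable without computing inverses.\<close>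

lemma (in group) conjugacy_class_iff:
  assumes g: "g \<in> carrier G"
  shows "h \<in> conjugacy_class G g \<longleftrightarrow>
    h \<in> carrier G \<and> (\<exists>z\<in>carrier G. h \<otimes> z = z \<otimes> g)"
proof
  assume "h \<in> conjugacy_class G g"
  then obtain z where "z \<in> carrier G" "h = z \<otimes> g \<otimes> inv z"
    by (auto simp: conjugacy_class_def)
  then show "h \<in> carrier G \<and> (\<exists>z\<in>carrier G. h \<otimes> z = z \<otimes> g)"
    using g by (auto simp: m_assoc intro!: bexI[of _ z])
next
  assume "h \<in> carrier G \<and> (\<exists>z\<in>carrier G. h \<otimes> z = z \<otimes> g)"
  then obtain z where "h \<in> carrier G" "z \<in> carrier G" "z \<otimes> g = h \<otimes> z"
    by auto
  then have "h = z \<otimes> g \<otimes> inv z"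
    by (simp add: m_assoc)
  with \<open>z \<in> carrier G\<close> show "h \<in> conjugacy_class G g"
    by (auto simp: conjugacy_class_def)
qed

lemma CSCom_iso_adjacent:
  assumes "group G" "group H" and h: "h \<in> iso G H"
    and x: "x \<in> carrier G" and y: "y \<in> carrier G"
  shows "(x, y) \<in> parcs (CSCom G) \<longleftrightarrow> (h x, h y) \<in> parcs (CSCom H)"
proof -
  interpret G: group G by fact
  interpret H: group H by fact
  have mult: "h (u \<otimes>\<^bsub>G\<^esub> v) = h u \<otimes>\<^bsub>H\<^esub> h v" if "u \<in> carrier G" "v \<in> carrier G" for u v
    using h that by (auto simp: iso_def hom_def)
  have inj: "h u = h v \<longleftrightarrow> u = v" if "u \<in> carrier G" "v \<in> carrier G" for u v
    using h that by (auto simp: iso_def bij_betw_def dest: inj_onD)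
  have img: "carrier H = h ` carrier G"
    using h by (auto simp: iso_def bij_betw_def)
  have conj: "h u \<in> conjugacy_class H (h v) \<longleftrightarrow> u \<in> conjugacy_class G v"
    if "u \<in> carrier G" "v \<in> carrier G" for u v
    using that by (auto simp: G.conjugacy_class_iff H.conjugacy_class_iff img
        mult[symmetric] inj)
  have sub: "conjugacy_class G u \<subseteq> carrier G" if "u \<in> carrier G" for u
    using that by (auto simp: G.conjugacy_class_iff)
  have image: "conjugacy_class H (h u) = h ` conjugacy_class G u" if u: "u \<in> carrier G" for u
  proof -
    have "conjugacy_class H (h u) \<subseteq> h ` carrier G"
      using u by (auto simp: H.conjugacy_class_iff img)
    then show ?thesis
      using conj[OF _ u] sub[OF u] by blast
  qed
  have comm: "h u \<otimes>\<^bsub>H\<^esub> h v = h v \<otimes>\<^bsub>H\<^esub> h u \<longleftrightarrow> u \<otimes>\<^bsub>G\<^esub> v = v \<otimes>\<^bsub>G\<^esub> u"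
    if "u \<in> conjugacy_class G x" "v \<in> conjugacy_class G y" for u v
    using that sub x y by (auto simp: mult[symmetric] inj subset_iff)
  have "h y \<in> h ` conjugacy_class G x \<longleftrightarrow> y \<in> conjugacy_class G x"
    using conj[OF y x] image[OF x] by simp
  then show ?thesis
    using x y by (simp add: CSCom_def inj image comm img)
qed

lemma CSCom_cong_iso:
  assumes "group G" "group H" and h: "h \<in> iso G H"
  shows "CSCom G \<cong>\<^sub>G CSCom H"
proof -
  have "bij_betw h (pverts (CSCom G)) (pverts (CSCom H))"
    using h by (simp add: CSCom_def iso_def)
  then show ?thesis
    unfolding graph_iso_iff[OF wf_CSCom wf_CSCom]
    using CSCom_iso_adjacent[OF assms] by (intro exI[of _ h]) (simp add: CSCom_def)
qed

section \<open>A semidirect product of \<open>\<int>/2n\<close> and \<open>\<int>/3\<close>\<close>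

text \<open>
  Multiplication by \<open>(-1)\<^sup>k\<close> modulo 3, with \<open>-1\<close> represented by 2 to stay in the natural
  numbers: the effect on the exponent of \<open>b\<close> of moving \<open>b\<^sup>j\<close> to the right past \<open>a\<^sup>k\<close>.
\<close>

definition twist :: "nat \<Rightarrow> nat \<Rightarrow> nat" where
  "twist k j = (if even k then j else 2 * j)"

lemma twist_mod: "twist k (j mod 3) mod 3 = twist k j mod 3"
  by (simp add: twist_def mod_mult_right_eq)

lemma twist_add: "twist k (j + l) = twist k j + twist k l"
  by (simp add: twist_def)

lemma twist_twist: "twist ((k + p) mod (2 * n)) j mod 3 = twist p (twist k j) mod 3"
proof -
  have "(2 * (2 * j)) mod 3 = j mod 3" by presburger
  then show ?thesis
    by (auto simp: twist_def dvd_mod_iff)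
qed

text \<open>The pair \<open>(i, j)\<close> stands for \<open>a\<^sup>i b\<^sup>j\<close>.\<close>

definition semidirect :: "nat \<Rightarrow> (nat \<times> nat) monoid" where
  "semidirect n =
    \<lparr> carrier = {..<2 * n} \<times> {..<3},
      monoid.mult = (\<lambda>(i, j) (k, l). ((i + k) mod (2 * n), (twist k j + l) mod 3)),
      one = (0, 0) \<rparr>"

lemma carrier_semidirect: "carrier (semidirect n) = {..<2 * n} \<times> {..<3}"
  by (simp add: semidirect_def)

lemma mult_semidirect:
  "(i, j) \<otimes>\<^bsub>semidirect n\<^esub> (k, l) = ((i + k) mod (2 * n), (twist k j + l) mod 3)"
  by (simp add: semidirect_def)

lemma one_semidirect: "\<one>\<^bsub>semidirect n\<^esub> = (0, 0)"
  by (simp add: semidirect_def)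

lemma less_3_cases:
  assumes "(j::nat) < 3"
  obtains "j = 0" | "j = 1" | "j = 2"
  using assms by linarith

lemma group_semidirect:
  assumes n: "n \<ge> 1"
  shows "group (semidirect n)"
proof (rule groupI)
  fix x y assume "x \<in> carrier (semidirect n)" "y \<in> carrier (semidirect n)"
  then show "x \<otimes>\<^bsub>semidirect n\<^esub> y \<in> carrier (semidirect n)"
    using n by (cases x; cases y) (simp add: mult_semidirect carrier_semidirect)
next
  show "\<one>\<^bsub>semidirect n\<^esub> \<in> carrier (semidirect n)"
    using n by (simp add: one_semidirect carrier_semidirect)
next
  fix x y z :: "nat \<times> nat"
  obtain i j k l p q where xyz: "x = (i, j)" "y = (k, l)" "z = (p, q)"
    by (cases x, cases y, cases z)
  have "(twist p ((twist k j + l) mod 3) + q) mod 3 =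
      (twist p ((twist k j + l) mod 3) mod 3 + q) mod 3"
    by (simp add: mod_add_left_eq)
  also have "\<dots> = (twist p (twist k j) + (twist p l + q)) mod 3"
    by (simp add: twist_mod twist_add mod_add_left_eq add.assoc)
  also have "\<dots> = (twist ((k + p) mod (2 * n)) j + (twist p l + q) mod 3) mod 3"
    by (intro mod_add_cong) (simp_all add: twist_twist)
  finally have "(twist p ((twist k j + l) mod 3) + q) mod 3 =
      (twist ((k + p) mod (2 * n)) j + (twist p l + q) mod 3) mod 3" .
  then show "x \<otimes>\<^bsub>semidirect n\<^esub> y \<otimes>\<^bsub>semidirect n\<^esub> z =
      x \<otimes>\<^bsub>semidirect n\<^esub> (y \<otimes>\<^bsub>semidirect n\<^esub> z)"
    by (simp add: xyz mult_semidirect mod_simps add.assoc)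
next
  fix x assume "x \<in> carrier (semidirect n)"
  then obtain i j where x: "x = (i, j)" "i < 2 * n" "j < 3"
    by (auto simp: carrier_semidirect)
  show "\<one>\<^bsub>semidirect n\<^esub> \<otimes>\<^bsub>semidirect n\<^esub> x = x"
    using x by (simp add: one_semidirect mult_semidirect twist_def)
  \<comment> \<open>The inverse of \<open>a\<^sup>i b\<^sup>j\<close> is \<open>b\<^sup>-\<^sup>j a\<^sup>-\<^sup>i\<close>, where the exponent \<open>-j\<close> is \<open>2j\<close> modulo 3.\<close>
  have "(twist i (twist i (2 * j) mod 3) + j) mod 3 = 0"
    using x(3) by (cases rule: less_3_cases) (auto simp: twist_def)
  then have "((2 * n - i) mod (2 * n), twist i (2 * j) mod 3) \<otimes>\<^bsub>semidirect n\<^esub> x =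
      \<one>\<^bsub>semidirect n\<^esub>"
    using x by (simp add: one_semidirect mult_semidirect mod_simps)
  moreover have "((2 * n - i) mod (2 * n), twist i (2 * j) mod 3) \<in> carrier (semidirect n)"
    using n by (simp add: carrier_semidirect)
  ultimately show "\<exists>y\<in>carrier (semidirect n). y \<otimes>\<^bsub>semidirect n\<^esub> x = \<one>\<^bsub>semidirect n\<^esub>"
    by blast
qed

lemma semidirect_power:
  assumes n: "n \<ge> 1"
  shows "(1, 0) [^]\<^bsub>semidirect n\<^esub> (i::nat) = (i mod (2 * n), 0)"
    and "(0, 1) [^]\<^bsub>semidirect n\<^esub> (j::nat) = (0, j mod 3)"
proof -
  interpret group "semidirect n" using n by (rule group_semidirect)
  show "(1, 0) [^]\<^bsub>semidirect n\<^esub> (i::nat) = (i mod (2 * n), 0)"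
    by (induction i) (simp_all add: one_semidirect mult_semidirect twist_def mod_simps)
  show "(0, 1) [^]\<^bsub>semidirect n\<^esub> (j::nat) = (0, j mod 3)"
    by (induction j) (simp_all add: one_semidirect mult_semidirect twist_def mod_simps)
qed

section \<open>Normal forms and the isomorphism with the presented group\<close>

lemma (in monoid) word_eval_replicate_append:
  assumes x: "f x \<in> carrier G" and v: "word_eval G f v \<in> carrier G"
  shows "word_eval G f (replicate m (Pos x) @ v) = f x [^] m \<otimes> word_eval G f v"
proof (induction m)
  case 0
  show ?case using v by simp
next
  case (Suc m)
  have "word_eval G f (replicate (Suc m) (Pos x) @ v) = f x \<otimes> f x [^] m \<otimes> word_eval G f v"
    using x v by (simp add: Suc.IH m_assoc)
  then show ?case
    by (simp only: nat_pow_Suc2[OF x])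
qed

lemma (in monoid) word_eval_replicate:
  assumes "f x \<in> carrier G"
  shows "word_eval G f (replicate m (Pos x)) = f x [^] m"
  using word_eval_replicate_append[of f x "[]" m] assms by simp

text \<open>
  Since \<open>a\<close> and \<open>b\<close> have finite order, only nonnegative powers are needed; \<open>b a = a b\<^sup>2\<close>
  moves \<open>b\<close> past \<open>a\<^sup>i\<close> at the price of squaring it \<open>i\<close> times. The set of all
  \<open>a\<^sup>i b\<^sup>j\<close> is therefore stable under left multiplication by the generators and their
  inverses.
\<close>

lemma (in group) word_eval_normal_form:
  fixes f :: "U6n_gen \<Rightarrow> 'a" and n :: nat
  assumes f: "f gen_a = a" "f gen_b = b"
    and a: "a \<in> carrier G" and b: "b \<in> carrier G"
    and a_order: "a [^] (2 * n) = \<one>" and b_order: "b [^] (3::nat) = \<one>"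
    and conj: "inv a \<otimes> (b \<otimes> a) = inv b" and n: "n \<ge> 1"
  shows "\<exists>i<2 * n. \<exists>j<(3::nat). word_eval G f w = a [^] i \<otimes> b [^] j"
proof -
  have a_mod: "a [^] (i mod (2 * n)) = a [^] i" for i
  proof -
    have "a [^] i = a [^] (2 * n * (i div (2 * n)) + i mod (2 * n))" by simp
    also have "\<dots> = a [^] (i mod (2 * n))"
      by (simp only: nat_pow_mult[symmetric] nat_pow_pow[symmetric] a a_order) (simp add: a)
    finally show ?thesis by simp
  qed
  have b_mod: "b [^] (j mod 3) = b [^] j" for j :: nat
  proof -
    have "b [^] j = b [^] (3 * (j div 3) + j mod 3)" by simp
    also have "\<dots> = b [^] (j mod 3)"
      by (simp only: nat_pow_mult[symmetric] nat_pow_pow[symmetric] b b_order) (simp add: b)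
    finally show ?thesis by simp
  qed
  have inv_a: "inv a = a [^] (2 * n - 1)"
  proof (rule inv_equality)
    have "a [^] (2 * n - 1) \<otimes> a = a [^] Suc (2 * n - 1)" by simp
    also have "\<dots> = \<one>" using n a_order by (simp del: nat_pow_Suc)
    finally show "a [^] (2 * n - 1) \<otimes> a = \<one>" .
  qed (use a in auto)
  have inv_b: "inv b = b [^] (2::nat)"
    by (rule inv_equality) (use b b_order in \<open>simp_all add: numeral_eq_Suc\<close>)
  have "b \<otimes> a = a \<otimes> inv b"
    using conj a b by (simp add: inv_solve_left')
  then have swap: "b \<otimes> a = a \<otimes> b [^] (2::nat)"
    by (simp add: inv_b)
  have swap_b: "b [^] (m::nat) \<otimes> a = a \<otimes> b [^] (2 * m)" for m
  proof (induction m)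
    case 0
    show ?case using a by simp
  next
    case (Suc m)
    have "b [^] Suc m \<otimes> a = b [^] m \<otimes> a \<otimes> b [^] (2::nat)"
      using a b by (simp add: m_assoc swap)
    also have "\<dots> = a \<otimes> (b [^] (2 * m) \<otimes> b [^] (2::nat))"
      using a b by (simp add: Suc.IH m_assoc)
    also have "\<dots> = a \<otimes> b [^] (2 * Suc m)"
      using b by (simp add: nat_pow_mult)
    finally show ?case .
  qed
  have swap_a: "b [^] (m::nat) \<otimes> a [^] (i::nat) = a [^] i \<otimes> b [^] (2 ^ i * m)" for i m
  proof (induction i)
    case 0
    show ?case using b by simp
  next
    case (Suc i)
    have "b [^] m \<otimes> a [^] Suc i = b [^] m \<otimes> a [^] i \<otimes> a"
      using a b by (simp add: m_assoc)
    also have "\<dots> = a [^] i \<otimes> (b [^] (2 ^ i * m) \<otimes> a)"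
      using a b by (simp add: Suc.IH m_assoc)
    also have "\<dots> = a [^] Suc i \<otimes> b [^] (2 ^ Suc i * m)"
      using a b by (simp add: swap_b m_assoc mult.assoc)
    finally show ?case .
  qed
  have letter: "\<exists>k m. letter_eval G f c = a [^] (k::nat) \<otimes> b [^] (m::nat)" for c
  proof (cases c)
    case (Pos x)
    show ?thesis
    proof (cases x)
      case gen_a
      then show ?thesis using Pos f a b by (intro exI[of _ 1] exI[of _ 0]) simp
    next
      case gen_b
      then show ?thesis using Pos f a b by (intro exI[of _ 0] exI[of _ 1]) simp
    qed
  next
    case (Neg x)
    show ?thesis
    proof (cases x)
      case gen_a
      then show ?thesis using Neg f a b
        by (intro exI[of _ "2 * n - 1"] exI[of _ 0]) (simp add: inv_a)
    next
      case gen_b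
      then show ?thesis using Neg f a b
        by (intro exI[of _ 0] exI[of _ 2]) (simp add: inv_b)
    qed
  qed
  have "\<exists>i j. word_eval G f w = a [^] (i::nat) \<otimes> b [^] (j::nat)"
  proof (induction w)
    case Nil
    show ?case by (intro exI[of _ 0]) simp
  next
    case (Cons c w)
    obtain i j :: nat where w: "word_eval G f w = a [^] i \<otimes> b [^] j"
      using Cons.IH by blast
    obtain k m :: nat where c: "letter_eval G f c = a [^] k \<otimes> b [^] m"
      using letter by blast
    have "word_eval G f (c # w) = a [^] k \<otimes> (b [^] m \<otimes> a [^] i) \<otimes> b [^] j"
      using a b by (simp add: w c m_assoc)
    also have "\<dots> = (a [^] k \<otimes> a [^] i) \<otimes> (b [^] (2 ^ i * m) \<otimes> b [^] j)"
      using a b by (simp add: swap_a m_assoc)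
    also have "\<dots> = a [^] (k + i) \<otimes> b [^] (2 ^ i * m + j)"
      using a b by (simp add: nat_pow_mult)
    finally show ?case by blast
  qed
  then obtain i j :: nat where "word_eval G f w = a [^] i \<otimes> b [^] j"
    by blast
  then have "word_eval G f w = a [^] (i mod (2 * n)) \<otimes> b [^] (j mod 3)"
    by (simp add: a_mod b_mod)
  moreover have "i mod (2 * n) < 2 * n" "j mod 3 < 3"
    using n by simp_all
  ultimately show ?thesis by blast
qed

lemma U6n_normal_form:
  assumes n: "n \<ge> 1" and x: "x \<in> carrier (U6n n)"
  shows "\<exists>i<2 * n. \<exists>j<3. x = word_class (U6n_rels n)
    (replicate i (Pos gen_a) @ replicate j (Pos gen_b))"
proof -
  define R where "R = U6n_rels n"
  interpret group "presented_group R" by (rule group_presented_group)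
  define f where "f x = word_class R [Pos x]" for x
  have f: "f x \<in> carrier (presented_group R)" for x
    by (simp add: f_def word_class_closed)
  have eval: "word_eval (presented_group R) f w = word_class R w" for w
    unfolding f_def by (rule word_eval_presented_group)
  have rel: "word_eval (presented_group R) f u = word_eval (presented_group R) f v"
    if "(u, v) \<in> R" for u v
    using that unfolding f_def by (rule presented_group_relation)
  have R: "(replicate (2 * n) (Pos gen_a), []) \<in> R" "(replicate 3 (Pos gen_b), []) \<in> R"
    "([Neg gen_a, Pos gen_b, Pos gen_a], [Neg gen_b]) \<in> R"
    by (auto simp: R_def U6n_rels_def)
  obtain w where w: "x = word_class R w"
    using x by (auto simp: U6n_def presented_group_def R_def)
  obtain i j where ij: "i < 2 * n" "j < (3::nat)" and
    "x = f gen_a [^]\<^bsub>presented_group R\<^esub> i \<otimes>\<^bsub>presented_group R\<^esub> f gen_b [^]\<^bsub>presented_group R\<^esub> j"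
    using word_eval_normal_form[of f "f gen_a" "f gen_b" n w] rel[OF R(1)] rel[OF R(2)]
      rel[OF R(3)] f n
    by (auto simp: word_eval_replicate eval[of w] w simp del: replicate.simps)
  then have "x = word_class R (replicate i (Pos gen_a) @ replicate j (Pos gen_b))"
    using f by (simp add: word_eval_replicate[symmetric] eval mult_presented_group)
  with ij show ?thesis
    unfolding R_def by blast
qed

text \<open>
  The pairs satisfy the defining relations, which yields a homomorphism from the presented
  group. It undoes the map that sends \<open>(i, j)\<close> to the class of the word \<open>a\<^sup>i b\<^sup>j\<close>;
  that map is onto because every element has a normal form, so both maps are bijective.
\<close>

lemma U6n_iso_semidirect:
  assumes n: "n \<ge> 1"
  shows "\<exists>h. h \<in> iso (U6n n) (semidirect n)"
proof -
  interpret S: group "semidirect n" using n by (rule group_semidirect)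
  define f where "f x = (case x of gen_a \<Rightarrow> (1::nat, 0::nat) | gen_b \<Rightarrow> (0, 1))" for x
  have f: "f x \<in> carrier (semidirect n)" for x
    using n by (cases x) (auto simp: f_def carrier_semidirect)
  have power: "word_eval (semidirect n) f (replicate i (Pos gen_a)) = (i mod (2 * n), 0)"
    "word_eval (semidirect n) f (replicate i (Pos gen_b)) = (0, i mod 3)" for i
    unfolding S.word_eval_replicate[of f, OF f]
    using semidirect_power[OF n] by (simp_all add: f_def)
  have inv_b: "inv\<^bsub>semidirect n\<^esub> (f gen_b) = (0, 2)"
    using n f
    by (intro S.inv_equality)
      (simp_all add: f_def mult_semidirect one_semidirect carrier_semidirect twist_def)
  have "f gen_b \<otimes>\<^bsub>semidirect n\<^esub> f gen_a = f gen_a \<otimes>\<^bsub>semidirect n\<^esub> (0, 2)"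
    by (simp add: f_def mult_semidirect twist_def)
  then have "inv\<^bsub>semidirect n\<^esub> (f gen_a) \<otimes>\<^bsub>semidirect n\<^esub>
      (f gen_b \<otimes>\<^bsub>semidirect n\<^esub> f gen_a) = inv\<^bsub>semidirect n\<^esub> (f gen_b)"
    using f by (simp add: S.inv_solve_left' inv_b[symmetric])
  then have "word_eval (semidirect n) f u = word_eval (semidirect n) f v"
    if "(u, v) \<in> U6n_rels n" for u v
    using that f unfolding U6n_rels_def
    by (auto simp: power one_semidirect[symmetric] simp del: replicate.simps)
  then obtain h where hom: "h \<in> hom (U6n n) (semidirect n)"
    and h: "\<And>w. h (word_class (U6n_rels n) w) = word_eval (semidirect n) f w"
    using presented_group_universal[of "semidirect n" f "U6n_rels n"] S.group_axioms f
    unfolding U6n_def by blast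
  define nf where "nf = (\<lambda>(i, j). word_class (U6n_rels n)
    (replicate i (Pos gen_a) @ replicate j (Pos gen_b)))"
  have append: "word_eval (semidirect n) f (replicate i (Pos gen_a) @ replicate j (Pos gen_b)) =
      (i mod (2 * n), 0) \<otimes>\<^bsub>semidirect n\<^esub> (0, j mod 3)" for i j
    using S.word_eval_replicate_append[of f gen_a "replicate j (Pos gen_b)" i] f n
      semidirect_power(1)[OF n]
    by (simp add: power carrier_semidirect f_def)
  have h_nf: "h (nf p) = p" if "p \<in> carrier (semidirect n)" for p
    using that by (auto simp: nf_def h append mult_semidirect twist_def carrier_semidirect)
  have nf_onto: "\<exists>p\<in>carrier (semidirect n). x = nf p" if "x \<in> carrier (U6n n)" for x
    using U6n_normal_form[OF n that] by (fastforce simp: nf_def carrier_semidirect)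
  have nf_closed: "nf p \<in> carrier (U6n n)" for p
    by (cases p) (simp add: nf_def U6n_def word_class_closed)
  have "bij_betw h (carrier (U6n n)) (carrier (semidirect n))"
  proof (rule bij_betw_byWitness[where f' = nf])
    show "\<forall>x\<in>carrier (U6n n). nf (h x) = x"
      using nf_onto h_nf by fastforce
    show "h ` carrier (U6n n) \<subseteq> carrier (semidirect n)"
      using hom by (auto simp: hom_def)
  qed (use h_nf nf_closed in auto)
  with hom show ?thesis
    by (auto simp: iso_def)
qed

section \<open>Adjacency in the semidirect product\<close>

text \<open>
  The three parts of the graph are unions of conjugacy classes. The first exponents add up in
  the abelian group \<open>\<int>/2n\<close>, so conjugation cannot change them; and for even \<open>i\<close>, where
  \<open>a\<^sup>i\<close> is central, it can only change the sign of \<open>j\<close>.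
\<close>

lemma semidirect_conjugate:
  assumes n: "n \<ge> 1" and "(i, j) \<in> carrier (semidirect n)"
    and "(i', j') \<in> conjugacy_class (semidirect n) (i, j)"
  shows "i' = i" and "even i \<Longrightarrow> j' = 0 \<longleftrightarrow> j = 0"
proof -
  interpret group "semidirect n" using n by (rule group_semidirect)
  obtain k l where kl: "(k, l) \<in> carrier (semidirect n)" "(i', j') \<in> carrier (semidirect n)"
    "(i', j') \<otimes>\<^bsub>semidirect n\<^esub> (k, l) = (k, l) \<otimes>\<^bsub>semidirect n\<^esub> (i, j)"
    using assms(3) unfolding conjugacy_class_iff[OF assms(2)] by auto
  then have less: "i < 2 * n" "i' < 2 * n" "j < 3" "j' < 3" "l < 3"
    and fst: "(i' + k) mod (2 * n) = (i + k) mod (2 * n)"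
    and snd: "(twist k j' + l) mod 3 = (twist i l + j) mod 3"
    using assms(2) by (auto simp: carrier_semidirect mult_semidirect add.commute)
  have "(i' + k + (2 * n - k)) mod (2 * n) = (i + k + (2 * n - k)) mod (2 * n)"
    using fst by (rule mod_add_cong) simp
  then show "i' = i"
    using less kl(1) by (simp add: carrier_semidirect)
  show "j' = 0 \<longleftrightarrow> j = 0" if "even i"
  proof (cases "even k")
    case True
    then have "(j' + l) mod 3 = (l + j) mod 3"
      using snd that by (simp add: twist_def)
    with less(3,4) show ?thesis by presburger
  next
    case False
    then have "(2 * j' + l) mod 3 = (l + j) mod 3"
      using snd that by (simp add: twist_def)
    with less(3,4) show ?thesis by presburger
  qed
qed

text \<open>
  As \<open>a\<^sup>i\<close> is central, the claim is about \<open>b\<^sup>j\<close> alone. For odd \<open>k\<close>, conjugation by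
  \<open>a\<^sup>k b\<^sup>l\<close> replaces \<open>j\<close> by \<open>-j\<close>, and \<open>2j\<close> is not 0 modulo 3.
\<close>

lemma semidirect_not_commute:
  assumes "even i" "j < 3" "j \<noteq> 0" "odd k"
  shows "(i, j) \<otimes>\<^bsub>semidirect n\<^esub> (k, l) \<noteq> (k, l) \<otimes>\<^bsub>semidirect n\<^esub> (i, j)"
proof -
  have "(2 * j + l) mod 3 \<noteq> (l + j) mod 3"
    using assms(2,3) by presburger
  then show ?thesis
    using assms by (simp add: mult_semidirect twist_def)
qed

text \<open>
  The only pairs without an edge come from the preceding two lemmas. In all other cases
  either both first exponents are odd, and the two elements are conjugate to powers of \<open>a\<close>,
  or the elements commute themselves: one is central, or both have the form
  \<open>a\<^sup>i b\<^sup>j\<close> with \<open>i\<close> even.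
\<close>

lemma CSCom_semidirect_adjacent:
  assumes n: "n \<ge> 1"
    and x: "(i, j) \<in> carrier (semidirect n)" and y: "(k, l) \<in> carrier (semidirect n)"
  shows "((i, j), (k, l)) \<in> parcs (CSCom (semidirect n)) \<longleftrightarrow>
    (i, j) \<noteq> (k, l) \<and> \<not> (even i \<and> j \<noteq> 0 \<and> odd k) \<and> \<not> (odd i \<and> even k \<and> l \<noteq> 0)"
    (is "_ \<longleftrightarrow> _ \<and> \<not> ?BC \<and> \<not> ?CB")
proof -
  interpret group "semidirect n" using n by (rule group_semidirect)
  let ?cl = "conjugacy_class (semidirect n)"
  let ?adj = "(k, l) \<in> ?cl (i, j) \<or> (\<exists>g\<in>?cl (i, j). \<exists>h\<in>?cl (k, l).
    g \<otimes>\<^bsub>semidirect n\<^esub> h = h \<otimes>\<^bsub>semidirect n\<^esub> g)"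
  have less: "i < 2 * n" "k < 2 * n" "j < 3" "l < 3"
    using x y by (auto simp: carrier_semidirect)
  have self: "p \<in> ?cl p" if "p \<in> carrier (semidirect n)" for p
    using that by (auto simp: conjugacy_class_iff)
  have closed: "?cl p \<subseteq> carrier (semidirect n)" if "p \<in> carrier (semidirect n)" for p
    using that by (auto simp: conjugacy_class_iff)
  have not_adj: "\<not> (k' = i' \<or> (\<exists>g\<in>?cl (i', j'). \<exists>h\<in>?cl (k', l').
        g \<otimes>\<^bsub>semidirect n\<^esub> h = h \<otimes>\<^bsub>semidirect n\<^esub> g))"
    if "even i'" "j' \<noteq> 0" "odd k'" "(i', j') \<in> carrier (semidirect n)"
      "(k', l') \<in> carrier (semidirect n)" for i' j' k' l'
  proof -
    have "g \<otimes>\<^bsub>semidirect n\<^esub> h \<noteq> h \<otimes>\<^bsub>semidirect n\<^esub> g"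
      if g: "g \<in> ?cl (i', j')" and h: "h \<in> ?cl (k', l')" for g h
    proof -
      obtain j'' where "g = (i', j'')" "j'' \<noteq> 0"
        using semidirect_conjugate[OF n \<open>(i', j') \<in> _\<close>] g that \<open>even i'\<close> \<open>j' \<noteq> 0\<close>
        by (metis prod.exhaust)
      moreover have "j'' < 3"
        using closed[OF \<open>(i', j') \<in> _\<close>] g calculation by (auto simp: carrier_semidirect)
      moreover obtain l'' where "h = (k', l'')"
        using semidirect_conjugate(1)[OF n \<open>(k', l') \<in> _\<close>] h by (metis prod.exhaust)
      ultimately show ?thesis
        using semidirect_not_commute \<open>even i'\<close> \<open>odd k'\<close> by simp
    qed
    with \<open>even i'\<close> \<open>odd k'\<close> show ?thesis by blast
  qed
  have "\<not> ?adj" if ?BC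
    using not_adj[of i j k l] semidirect_conjugate(1)[OF n x] that x y by blast
  moreover have "\<not> ?adj" if ?CB
    using not_adj[of k l i j] semidirect_conjugate(1)[OF n x] that x y by metis
  moreover have "?adj" if "\<not> ?BC" "\<not> ?CB"
  proof (cases "odd i \<and> odd k")
    case True
    \<comment> \<open>\<open>b\<^sup>-\<^sup>j\<close> conjugates \<open>a\<^sup>i b\<^sup>j\<close> to \<open>a\<^sup>i\<close> for odd \<open>i\<close>; again \<open>-j\<close> is \<open>2j\<close> modulo 3.\<close>
    have conj: "(p, 0) \<in> ?cl (p, q)" if "odd p" "p < 2 * n" "q < 3" for p q
    proof -
      have "(p, 0) \<otimes>\<^bsub>semidirect n\<^esub> (0, 2 * q mod 3) = (0, 2 * q mod 3) \<otimes>\<^bsub>semidirect n\<^esub> (p, q)"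
        using that(3) that(1,2)
        by (cases rule: less_3_cases) (auto simp: mult_semidirect twist_def)
      moreover have "(p, q) \<in> carrier (semidirect n)" "(p, 0) \<in> carrier (semidirect n)"
        "(0, 2 * q mod 3) \<in> carrier (semidirect n)"
        using that n by (auto simp: carrier_semidirect)
      ultimately show ?thesis
        by (auto simp: conjugacy_class_iff)
    qed
    have "(i, 0) \<otimes>\<^bsub>semidirect n\<^esub> (k, 0) = (k, 0) \<otimes>\<^bsub>semidirect n\<^esub> (i, 0)"
      by (simp add: mult_semidirect twist_def add.commute)
    with True less show ?thesis
      using conj[of i j] conj[of k l] by blast
  next
    case False
    with that have "(i, j) \<otimes>\<^bsub>semidirect n\<^esub> (k, l) = (k, l) \<otimes>\<^bsub>semidirect n\<^esub> (i, j)"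
      by (auto simp: mult_semidirect twist_def add.commute)
    with self x y show ?thesis by blast
  qed
  moreover have "((i, j), (k, l)) \<in> parcs (CSCom (semidirect n)) \<longleftrightarrow>
      (i, j) \<noteq> (k, l) \<and> ?adj"
    using x y by (simp add: CSCom_def)
  ultimately show ?thesis by argo
qed

lemma card_even_below: "card {i. i < 2 * n \<and> even i} = n"
proof -
  have "{i. i < 2 * n \<and> even i} = (\<lambda>k. 2 * k) ` {..<n}"
    by (auto elim!: evenE)
  then show ?thesis
    by (simp add: card_image inj_on_def)
qed

lemma card_odd_below: "card {i. i < 2 * n \<and> odd i} = n"
proof -
  have "{i. i < 2 * n \<and> odd i} = (\<lambda>k. 2 * k + 1) ` {..<n}"
    by (auto elim!: oddE)
  then show ?thesis
    by (simp add: card_image inj_on_def)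
qed

lemma CSCom_semidirect:
  assumes n: "n \<ge> 1"
  shows "CSCom (semidirect n) \<cong>\<^sub>G
    complete_graph n \<or>\<^sub>G (complete_graph (2 * n) \<squnion>\<^sub>G complete_graph (3 * n))"
proof -
  define E where "E = {i. i < 2 * n \<and> even i}"
  define D where "D = {i. i < 2 * n \<and> odd i}"
  have E: "finite E" "card E = n"
    using card_even_below by (auto simp: E_def)
  have D: "finite D" "card D = n"
    using card_odd_below by (auto simp: D_def)
  have verts: "pverts (CSCom (semidirect n)) = carrier (semidirect n)"
    by (simp add: CSCom_def)
  show ?thesis
  proof (rule graph_iso_join_of_complete[OF wf_CSCom,
        where A = "E \<times> {0}" and B = "E \<times> {1, 2}" and C = "D \<times> {..<3}"])
    show "pverts (CSCom (semidirect n)) = E \<times> {0} \<union> E \<times> {1, 2} \<union> D \<times> {..<3}"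
      unfolding verts carrier_semidirect E_def D_def by (auto elim: less_3_cases)
  next
    fix u v assume uv: "u \<in> pverts (CSCom (semidirect n))" "v \<in> pverts (CSCom (semidirect n))"
    obtain i j k l where ijkl: "u = (i, j)" "v = (k, l)"
      by (cases u, cases v)
    then have less: "i < 2 * n" "k < 2 * n" "j < 3" "l < 3"
      using uv unfolding verts by (auto simp: carrier_semidirect)
    have "(i, j) \<in> E \<times> {1, 2} \<longleftrightarrow> even i \<and> j \<noteq> 0" "(k, l) \<in> E \<times> {1, 2} \<longleftrightarrow> even k \<and> l \<noteq> 0"
      "(i, j) \<in> D \<times> {..<3} \<longleftrightarrow> odd i" "(k, l) \<in> D \<times> {..<3} \<longleftrightarrow> odd k"
      using less by (auto simp: E_def D_def)
    then show "(u, v) \<in> parcs (CSCom (semidirect n)) \<longleftrightarrow> u \<noteq> v \<and>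
        \<not> (u \<in> E \<times> {1, 2} \<and> v \<in> D \<times> {..<3}) \<and> \<not> (u \<in> D \<times> {..<3} \<and> v \<in> E \<times> {1, 2})"
      using CSCom_semidirect_adjacent[OF n, of i j k l] uv unfolding verts ijkl by blast
  qed (use E D in \<open>auto simp: E_def D_def card_cartesian_product\<close>)
qed

theorem theorem2p8:
  fixes n :: nat
  assumes "n \<ge> 1"
  shows "CSCom (U6n n) \<cong>\<^sub>G
    complete_graph n \<or>\<^sub>G (complete_graph (2 * n) \<squnion>\<^sub>G complete_graph (3 * n))"
proof -
  obtain h where "h \<in> iso (U6n n) (semidirect n)"
    using U6n_iso_semidirect[OF assms] by blast
  then have "CSCom (U6n n) \<cong>\<^sub>G CSCom (semidirect n)"
    using group_semidirect[OF assms] group_presented_group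
    by (intro CSCom_cong_iso) (simp_all add: U6n_def)
  then show ?thesis
    using CSCom_semidirect[OF assms]
    by (rule graph_iso_trans[rotated 3])
      (intro wf_CSCom wf_graph_join wf_graph_disjoint_union wf_complete_graph)+
qed

end
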